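(* Let $\Sigma=(X,X_0,S,U,\to,Y,h)$ be a total NFTS and $\Sigma_V$ its verification system with state set $X_V$. Then $\Sigma$ is initial-state opaque if and only if for every $(q^1,q^2)\in X_V$: if $q^2\cap X_0\neq\emptyset$ then $q^2\cap X_0\not\subseteq S$.
   Context: An NFTS is a tuple $\Sigma=(X,X_0,S,U,\to,Y,h)$ with $X$ a finite set of states, $X_0\subseteq X$ initial states, $S\subseteq X$ secret states, $U$ a finite set of inputs, $\to\subseteq X\times U\times X$ the transition relation (write $x\xrightarrow{u}x'$), $Y$ a set of outputs and $h:X\to Y$. It is total if for every $x\in X$, $u\in U$ there is $x'$ with $x\xrightarrow{u}x'$. For $\alpha=\alpha(0)\cdots\alpha(|\alpha|-1)\in U^*$ (finite sequences, including empty), a run over $\alpha$ is a nonempty sequence $x_0\dots x_k$ with $k\le|\alpha|$, $x_0\in X_0$, $(x_j,\alpha(j),x_{j+1})\in\to$ for $j<k$; it is maximal if $k=|\alpha|$ or no $x'$ satisfies $(x_k,\alpha(k),x')\in\to$. $\Sigma$ is initial-state opaque if for every $\alpha\in U^*$ and every maximal run $x_0\dots x_k$ over $\alpha$ with $x_0\in X_0\cap S$ there is a maximal run $x_0'\dots x_k'$ over $\alpha$ with $x_0'\notin S$ and $h(x_j)=h(x_j')$ for all $j\in\{0,\dots,k\}$. For $y\in Y$ let $X_y=\{x\mid h(x)=y\}$, $X_{0,y}=X_0\cap X_y$; for $q\subseteq X$, $u\in U$, $\mathrm{suc}(q,u)=\{x\mid\exists x'\in q,(x',u,x)\in\to\}$,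 $\mathrm{post}(q,u)=\{x\mid\exists x'\in q,(x,u,x')\in\to\}$. Let $\epsilon\notin U$. The verification system $\Sigma_V$ has input set $U_V=(U\times\{\epsilon\})\cup(\{\epsilon\}\times U)$, initial states $X_{V,0}=\{(X_{0,y_1},X_{y_2})\mid y_1,y_2\in Y,\ X_{0,y_1}\neq\emptyset,\ X_{y_2}\neq\emptyset\}$, transitions $(q_1,q_2)\xrightarrow{(u,\epsilon)}_V(q_1',q_2)$ iff $q_1'=\mathrm{suc}(q_1,u)\cap X_y\neq\emptyset$ for some $y\in Y$, and $(q_1,q_2)\xrightarrow{(\epsilon,u)}_V(q_1,q_2')$ iff $q_2'=\mathrm{post}(q_2,u)\cap X_y\neq\emptyset$ for some $y\in Y$; its state set $X_V$ is the set of pairs reachable from $X_{V,0}$ by finitely many transitions. *)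

theory Defs
  imports Main
begin

record ('x, 'u, 'y) nfts =
  states :: "'x set"
  init :: "'x set"
  secret :: "'x set"
  inputs :: "'u set"
  step :: "('x \<times> 'u \<times> 'x) set"
  outputs :: "'y set"
  out :: "'x \<Rightarrow> 'y"

definition is_nfts :: "('x, 'u, 'y) nfts \<Rightarrow> bool" where
  "is_nfts \<Sigma> \<longleftrightarrow>
     finite (states \<Sigma>) \<and> init \<Sigma> \<subseteq> states \<Sigma> \<and> secret \<Sigma> \<subseteq> states \<Sigma> \<and>
     finite (inputs \<Sigma>) \<and> step \<Sigma> \<subseteq> states \<Sigma> \<times> inputs \<Sigma> \<times> states \<Sigma> \<and>
     out \<Sigma> ` states \<Sigma> \<subseteq> outputs \<Sigma>"

definition is_total :: "('x, 'u, 'y) nfts \<Rightarrow> bool" where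
  "is_total \<Sigma> \<longleftrightarrow>
     (\<forall>x\<in>states \<Sigma>. \<forall>u\<in>inputs \<Sigma>. \<exists>x'\<in>states \<Sigma>. (x, u, x') \<in> step \<Sigma>)"

text \<open>A run \<open>x\<^sub>0 \<dots> x\<^sub>k\<close> is the list \<open>xs\<close> of its states, so \<open>k = length xs - 1\<close>.\<close>

definition is_run :: "('x, 'u, 'y) nfts \<Rightarrow> 'u list \<Rightarrow> 'x list \<Rightarrow> bool" where
  "is_run \<Sigma> \<alpha> xs \<longleftrightarrow>
     xs \<noteq> [] \<and> length xs - 1 \<le> length \<alpha> \<and> xs ! 0 \<in> init \<Sigma> \<and>
     (\<forall>j < length xs - 1. (xs ! j, \<alpha> ! j, xs ! (j + 1)) \<in> step \<Sigma>)"

definition is_maximal_run :: "('x, 'u, 'y) nfts \<Rightarrow> 'u list \<Rightarrow> 'x list \<Rightarrow> bool" where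
  "is_maximal_run \<Sigma> \<alpha> xs \<longleftrightarrow>
     is_run \<Sigma> \<alpha> xs \<and>
     (length xs - 1 = length \<alpha> \<or>
      \<not> (\<exists>x'. (xs ! (length xs - 1), \<alpha> ! (length xs - 1), x') \<in> step \<Sigma>))"

definition initial_state_opaque :: "('x, 'u, 'y) nfts \<Rightarrow> bool" where
  "initial_state_opaque \<Sigma> \<longleftrightarrow>
     (\<forall>\<alpha>\<in>lists (inputs \<Sigma>). \<forall>xs.
        is_maximal_run \<Sigma> \<alpha> xs \<and> xs ! 0 \<in> init \<Sigma> \<inter> secret \<Sigma> \<longrightarrow>
        (\<exists>xs'. is_maximal_run \<Sigma> \<alpha> xs' \<and> length xs' = length xs \<and>
               xs' ! 0 \<notin> secret \<Sigma> \<and>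
               (\<forall>j < length xs. out \<Sigma> (xs ! j) = out \<Sigma> (xs' ! j))))"

definition states_out :: "('x, 'u, 'y) nfts \<Rightarrow> 'y \<Rightarrow> 'x set" where
  "states_out \<Sigma> y = {x \<in> states \<Sigma>. out \<Sigma> x = y}"

definition init_out :: "('x, 'u, 'y) nfts \<Rightarrow> 'y \<Rightarrow> 'x set" where
  "init_out \<Sigma> y = init \<Sigma> \<inter> states_out \<Sigma> y"

definition suc :: "('x, 'u, 'y) nfts \<Rightarrow> 'x set \<Rightarrow> 'u \<Rightarrow> 'x set" where
  "suc \<Sigma> q u = {x \<in> states \<Sigma>. \<exists>x'\<in>q. (x', u, x) \<in> step \<Sigma>}"

text \<open>Despite its name, \<open>post\<close> collects the predecessors of \<open>q\<close>.\<close>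

definition post :: "('x, 'u, 'y) nfts \<Rightarrow> 'x set \<Rightarrow> 'u \<Rightarrow> 'x set" where
  "post \<Sigma> q u = {x \<in> states \<Sigma>. \<exists>x'\<in>q. (x, u, x') \<in> step \<Sigma>}"

text \<open>
  In the inputs of the verification system, \<open>None\<close> plays the role of the fresh symbol
  \<open>\<epsilon> \<notin> U\<close>, and \<open>u \<in> U\<close> is represented by \<open>Some u\<close>.
\<close>

definition ver_inputs :: "('x, 'u, 'y) nfts \<Rightarrow> ('u option \<times> 'u option) set" where
  "ver_inputs \<Sigma> = (Some ` inputs \<Sigma> \<times> {None}) \<union> ({None} \<times> Some ` inputs \<Sigma>)"

definition ver_init :: "('x, 'u, 'y) nfts \<Rightarrow> ('x set \<times> 'x set) set" where
  "ver_init \<Sigma> =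
     {(init_out \<Sigma> y1, states_out \<Sigma> y2) | y1 y2.
        y1 \<in> outputs \<Sigma> \<and> y2 \<in> outputs \<Sigma> \<and>
        init_out \<Sigma> y1 \<noteq> {} \<and> states_out \<Sigma> y2 \<noteq> {}}"

inductive ver_step ::
  "('x, 'u, 'y) nfts \<Rightarrow> 'x set \<times> 'x set \<Rightarrow> 'u option \<times> 'u option \<Rightarrow> 'x set \<times> 'x set \<Rightarrow> bool"
  for \<Sigma> :: "('x, 'u, 'y) nfts" where
  forward:
    "\<lbrakk>u \<in> inputs \<Sigma>; y \<in> outputs \<Sigma>; q1' = suc \<Sigma> q1 u \<inter> states_out \<Sigma> y; q1' \<noteq> {}\<rbrakk>
     \<Longrightarrow> ver_step \<Sigma> (q1, q2) (Some u, None) (q1', q2)"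
| backward:
    "\<lbrakk>u \<in> inputs \<Sigma>; y \<in> outputs \<Sigma>; q2' = post \<Sigma> q2 u \<inter> states_out \<Sigma> y; q2' \<noteq> {}\<rbrakk>
     \<Longrightarrow> ver_step \<Sigma> (q1, q2) (None, Some u) (q1, q2')"

definition ver_states :: "('x, 'u, 'y) nfts \<Rightarrow> ('x set \<times> 'x set) set" where
  "ver_states \<Sigma> =
     {p. \<exists>p0\<in>ver_init \<Sigma>. (\<lambda>p p'. \<exists>v\<in>ver_inputs \<Sigma>. ver_step \<Sigma> p v p')\<^sup>*\<^sup>* p0 p}"

end

theory Submission imports Defs begin

text \<open>
  The second component of the verification system evolves backwards: reading \<open>\<alpha>\<close> in reverse, it
  becomes the set of all start states of paths over \<open>\<alpha>\<close> that produce some fixed output sequence, and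
  as soon as initial states exist, every nonempty such set is reached. By totality, the maximal runs
  over \<open>\<alpha>\<close> are exactly the paths over all of \<open>\<alpha>\<close> that start in an initial state. Hence opacity says
  that no such set meets the initial states in secret states only.
\<close>

definition path_over :: "('x, 'u, 'y) nfts \<Rightarrow> 'u list \<Rightarrow> 'x list \<Rightarrow> bool" where
  "path_over \<Sigma> \<alpha> xs \<longleftrightarrow>
     length xs = Suc (length \<alpha>) \<and> set xs \<subseteq> states \<Sigma> \<and>
     (\<forall>j < length \<alpha>. (xs ! j, \<alpha> ! j, xs ! Suc j) \<in> step \<Sigma>)"

definition start_states :: "('x, 'u, 'y) nfts \<Rightarrow> 'u list \<Rightarrow> 'y list \<Rightarrow> 'x set" where
  "start_states \<Sigma> \<alpha> ys = {xs ! 0 | xs. path_over \<Sigma> \<alpha> xs \<and> map (out \<Sigma>) xs = ys}"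

lemma path_over_Nil: "path_over \<Sigma> [] xs \<longleftrightarrow> (\<exists>x\<in>states \<Sigma>. xs = [x])"
  by (auto simp: path_over_def length_Suc_conv)

lemma path_over_Cons:
  "path_over \<Sigma> (u # \<alpha>) (x # xs) \<longleftrightarrow>
     x \<in> states \<Sigma> \<and> (x, u, xs ! 0) \<in> step \<Sigma> \<and> path_over \<Sigma> \<alpha> xs"
  by (auto simp: path_over_def All_less_Suc2)

lemma start_states_Nil: "start_states \<Sigma> [] [y] = states_out \<Sigma> y"
  by (force simp: start_states_def states_out_def path_over_Nil)

lemma start_states_Cons:
  "start_states \<Sigma> (u # \<alpha>) (y # ys) = post \<Sigma> (start_states \<Sigma> \<alpha> ys) u \<inter> states_out \<Sigma> y"
proof -
  have "x \<in> start_states \<Sigma> (u # \<alpha>) (y # ys) \<longleftrightarrow>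
      (\<exists>xs. path_over \<Sigma> (u # \<alpha>) (x # xs) \<and> out \<Sigma> x = y \<and> map (out \<Sigma>) xs = ys)" for x
    by (force simp: start_states_def map_eq_Cons_conv)
  then show ?thesis
    by (auto simp: path_over_Cons start_states_def post_def states_out_def)
qed

lemma start_states_nonempty_length:
  "start_states \<Sigma> \<alpha> ys \<noteq> {} \<Longrightarrow> length ys = Suc (length \<alpha>)"
  by (auto simp: start_states_def path_over_def)

lemma states_out_nonempty_outputs:
  "is_nfts \<Sigma> \<Longrightarrow> states_out \<Sigma> y \<noteq> {} \<Longrightarrow> y \<in> outputs \<Sigma>"
  by (auto simp: is_nfts_def states_out_def)

lemma is_run_states:
  assumes nfts: "is_nfts \<Sigma>" and run: "is_run \<Sigma> \<alpha> xs"
  shows "set xs \<subseteq> states \<Sigma>"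
proof -
  have "xs ! j \<in> states \<Sigma>" if "j < length xs" for j
  proof (cases j)
    case 0
    then show ?thesis using nfts run by (auto simp: is_nfts_def is_run_def)
  next
    case (Suc i)
    then have "(xs ! i, \<alpha> ! i, xs ! j) \<in> step \<Sigma>" using run that by (auto simp: is_run_def)
    then show ?thesis using nfts by (auto simp: is_nfts_def)
  qed
  then show ?thesis by (auto simp: in_set_conv_nth)
qed

lemma is_maximal_run_length:
  assumes nfts: "is_nfts \<Sigma>" and total: "is_total \<Sigma>"
    and inputs: "\<alpha> \<in> lists (inputs \<Sigma>)" and maximal: "is_maximal_run \<Sigma> \<alpha> xs"
  shows "length xs = Suc (length \<alpha>)"
proof -
  let ?k = "length xs - 1"
  have run: "is_run \<Sigma> \<alpha> xs" using maximal by (simp add: is_maximal_run_def)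
  then have "xs \<noteq> []" and "?k \<le> length \<alpha>" by (simp_all add: is_run_def)
  have "\<not> ?k < length \<alpha>"
  proof
    assume "?k < length \<alpha>"
    then have "\<alpha> ! ?k \<in> inputs \<Sigma>" using inputs by auto
    moreover have "xs ! ?k \<in> states \<Sigma>"
      using is_run_states[OF nfts run] \<open>xs \<noteq> []\<close> by (simp add: subset_iff)
    ultimately have "\<exists>x'. (xs ! ?k, \<alpha> ! ?k, x') \<in> step \<Sigma>"
      using total by (auto simp: is_total_def)
    then show False using maximal \<open>?k < length \<alpha>\<close> by (simp add: is_maximal_run_def)
  qed
  then show ?thesis using \<open>xs \<noteq> []\<close> \<open>?k \<le> length \<alpha>\<close> by (cases xs) auto
qed

lemma is_maximal_run_iff_path_over:
  assumes "is_nfts \<Sigma>" and "is_total \<Sigma>" and "\<alpha> \<in> lists (inputs \<Sigma>)"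
  shows "is_maximal_run \<Sigma> \<alpha> xs \<longleftrightarrow> path_over \<Sigma> \<alpha> xs \<and> xs ! 0 \<in> init \<Sigma>"
proof
  assume maximal: "is_maximal_run \<Sigma> \<alpha> xs"
  then have run: "is_run \<Sigma> \<alpha> xs" by (simp add: is_maximal_run_def)
  show "path_over \<Sigma> \<alpha> xs \<and> xs ! 0 \<in> init \<Sigma>"
    using run is_run_states[OF assms(1) run] is_maximal_run_length[OF assms maximal]
    by (auto simp: is_run_def path_over_def)
next
  assume "path_over \<Sigma> \<alpha> xs \<and> xs ! 0 \<in> init \<Sigma>"
  then show "is_maximal_run \<Sigma> \<alpha> xs"
    by (auto simp: is_maximal_run_def is_run_def path_over_def)
qed

lemma initial_state_opaque_iff_path_over:
  assumes "is_nfts \<Sigma>" and "is_total \<Sigma>"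
  shows "initial_state_opaque \<Sigma> \<longleftrightarrow>
    (\<forall>\<alpha>\<in>lists (inputs \<Sigma>). \<forall>xs. path_over \<Sigma> \<alpha> xs \<and> xs ! 0 \<in> init \<Sigma> \<inter> secret \<Sigma> \<longrightarrow>
       (\<exists>xs'. path_over \<Sigma> \<alpha> xs' \<and> map (out \<Sigma>) xs' = map (out \<Sigma>) xs \<and>
              xs' ! 0 \<in> init \<Sigma> - secret \<Sigma>))"
proof -
  have same_outputs: "map (out \<Sigma>) xs' = map (out \<Sigma>) xs \<longleftrightarrow>
      length xs' = length xs \<and> (\<forall>j < length xs. out \<Sigma> (xs ! j) = out \<Sigma> (xs' ! j))" for xs xs'
    by (auto simp: map_equality_iff)
  show ?thesis
    unfolding initial_state_opaque_def same_outputs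
    by (intro ball_cong all_cong refl) (auto simp: is_maximal_run_iff_path_over[OF assms])
qed

lemma initial_state_opaque_iff_start_states:
  assumes "is_nfts \<Sigma>" and "is_total \<Sigma>"
  shows "initial_state_opaque \<Sigma> \<longleftrightarrow>
    (\<forall>\<alpha>\<in>lists (inputs \<Sigma>). \<forall>ys. start_states \<Sigma> \<alpha> ys \<inter> init \<Sigma> \<noteq> {} \<longrightarrow>
       \<not> (start_states \<Sigma> \<alpha> ys \<inter> init \<Sigma> \<subseteq> secret \<Sigma>))"
  unfolding initial_state_opaque_iff_path_over[OF assms] start_states_def
  by blast

lemma ver_states_init: "p \<in> ver_init \<Sigma> \<Longrightarrow> p \<in> ver_states \<Sigma>"
  by (auto simp: ver_states_def)

lemma ver_step_inputs: "ver_step \<Sigma> p v p' \<Longrightarrow> v \<in> ver_inputs \<Sigma>"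
  by (auto simp: ver_inputs_def elim: ver_step.cases)

lemma ver_states_step: "p \<in> ver_states \<Sigma> \<Longrightarrow> ver_step \<Sigma> p v p' \<Longrightarrow> p' \<in> ver_states \<Sigma>"
  unfolding ver_states_def by (blast intro: rtranclp.rtrancl_into_rtrancl ver_step_inputs)

lemma ver_states_induct [consumes 1, case_names init step]:
  assumes "p \<in> ver_states \<Sigma>"
    and "\<And>p. p \<in> ver_init \<Sigma> \<Longrightarrow> P p"
    and "\<And>p v p'. p \<in> ver_states \<Sigma> \<Longrightarrow> P p \<Longrightarrow> ver_step \<Sigma> p v p' \<Longrightarrow> P p'"
  shows "P p"
proof -
  obtain p0 where "p0 \<in> ver_init \<Sigma>"
    and "(\<lambda>p p'. \<exists>v\<in>ver_inputs \<Sigma>. ver_step \<Sigma> p v p')\<^sup>*\<^sup>* p0 p"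
    using assms(1) by (auto simp: ver_states_def)
  from this(2) have "p \<in> ver_states \<Sigma> \<and> P p"
  proof (induction rule: rtranclp_induct)
    case base
    show ?case using \<open>p0 \<in> ver_init \<Sigma>\<close> assms(2) by (blast intro: ver_states_init)
  next
    case (step p p')
    then show ?case using assms(3) by (blast intro: ver_states_step)
  qed
  then show ?thesis ..
qed

lemma ver_states_snd_start_states:
  assumes "p \<in> ver_states \<Sigma>"
  shows "snd p \<noteq> {} \<and> (\<exists>\<alpha>\<in>lists (inputs \<Sigma>). \<exists>ys. snd p = start_states \<Sigma> \<alpha> ys)"
  using assms
proof (induction rule: ver_states_induct)
  case (init p)
  then obtain y0 y where "p = (init_out \<Sigma> y0, states_out \<Sigma> y)" and "states_out \<Sigma> y \<noteq> {}"
    unfolding ver_init_def by blast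
  then have "snd p \<noteq> {}" and "snd p = start_states \<Sigma> [] [y]"
    by (simp_all add: start_states_Nil)
  then show ?case by blast
next
  case (step p v p')
  from step.hyps(2) show ?case
  proof cases
    case forward
    then show ?thesis using step.IH by simp
  next
    case (backward u y q2' q2 q1)
    obtain \<alpha> ys where "\<alpha> \<in> lists (inputs \<Sigma>)" and "q2 = start_states \<Sigma> \<alpha> ys"
      using step.IH backward by auto
    then have "u # \<alpha> \<in> lists (inputs \<Sigma>)" and "snd p' = start_states \<Sigma> (u # \<alpha>) (y # ys)"
      using backward by (simp_all add: start_states_Cons)
    moreover have "snd p' \<noteq> {}" using backward by simp
    ultimately show ?thesis by blast
  qed
qed

lemma start_states_in_ver_states:
  assumes nfts: "is_nfts \<Sigma>" and y0_init: "init_out \<Sigma> y0 \<noteq> {}"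
    and "\<alpha> \<in> lists (inputs \<Sigma>)" and "start_states \<Sigma> \<alpha> ys \<noteq> {}"
  shows "(init_out \<Sigma> y0, start_states \<Sigma> \<alpha> ys) \<in> ver_states \<Sigma>"
  using assms(3,4)
proof (induction \<alpha> arbitrary: ys rule: lists.induct)
  case Nil
  then obtain y where ys_eq: "ys = [y]"
    using start_states_nonempty_length by (fastforce simp: length_Suc_conv)
  then have "states_out \<Sigma> y \<noteq> {}" using Nil by (simp add: start_states_Nil)
  moreover have "states_out \<Sigma> y0 \<noteq> {}" using y0_init by (auto simp: init_out_def)
  ultimately have "(init_out \<Sigma> y0, states_out \<Sigma> y) \<in> ver_init \<Sigma>"
    using y0_init states_out_nonempty_outputs[OF nfts] unfolding ver_init_def by blast
  then show ?case by (simp add: ys_eq start_states_Nil ver_states_init)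
next
  case (Cons u \<alpha>)
  obtain y zs where ys_eq: "ys = y # zs"
    using start_states_nonempty_length[OF Cons.prems] by (auto simp: length_Suc_conv)
  let ?q = "start_states \<Sigma> \<alpha> zs" and ?q' = "start_states \<Sigma> (u # \<alpha>) ys"
  have q'_eq: "?q' = post \<Sigma> ?q u \<inter> states_out \<Sigma> y" by (simp add: ys_eq start_states_Cons)
  have "?q \<noteq> {}" and "states_out \<Sigma> y \<noteq> {}"
    using Cons.prems by (auto simp: q'_eq post_def)
  have "ver_step \<Sigma> (init_out \<Sigma> y0, ?q) (None, Some u) (init_out \<Sigma> y0, ?q')"
    using Cons.hyps(1) states_out_nonempty_outputs[OF nfts \<open>states_out \<Sigma> y \<noteq> {}\<close>] q'_eq Cons.prems
    by (rule ver_step.backward)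
  then show ?case using Cons.IH[OF \<open>?q \<noteq> {}\<close>] by (rule ver_states_step[rotated])
qed

lemma snd_ver_states:
  assumes nfts: "is_nfts \<Sigma>" and "init \<Sigma> \<noteq> {}"
  shows "snd ` ver_states \<Sigma> =
    {start_states \<Sigma> \<alpha> ys | \<alpha> ys. \<alpha> \<in> lists (inputs \<Sigma>) \<and> start_states \<Sigma> \<alpha> ys \<noteq> {}}"
proof -
  obtain x0 where "x0 \<in> init \<Sigma>" using assms(2) by blast
  then have "init_out \<Sigma> (out \<Sigma> x0) \<noteq> {}"
    using nfts by (auto simp: is_nfts_def init_out_def states_out_def)
  note reachable = start_states_in_ver_states[OF nfts this]
  show ?thesis
  proof (intro subset_antisym subsetI)
    fix q assume "q \<in> snd ` ver_states \<Sigma>"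
    then show "q \<in> {start_states \<Sigma> \<alpha> ys | \<alpha> ys.
        \<alpha> \<in> lists (inputs \<Sigma>) \<and> start_states \<Sigma> \<alpha> ys \<noteq> {}}"
      using ver_states_snd_start_states by fastforce
  qed (use reachable in force)
qed

theorem theorem5p3:
  fixes \<Sigma> :: "('x, 'u, 'y) nfts"
  assumes "is_nfts \<Sigma>" and "is_total \<Sigma>"
  shows "initial_state_opaque \<Sigma> \<longleftrightarrow>
    (\<forall>(q1, q2)\<in>ver_states \<Sigma>.
       q2 \<inter> init \<Sigma> \<noteq> {} \<longrightarrow> \<not> (q2 \<inter> init \<Sigma> \<subseteq> secret \<Sigma>))"
proof (cases "init \<Sigma> = {}")
  case True
  then show ?thesis by (simp add: initial_state_opaque_iff_start_states[OF assms])
next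
  case False
  let ?revealing = "\<lambda>q. q \<inter> init \<Sigma> \<noteq> {} \<and> q \<inter> init \<Sigma> \<subseteq> secret \<Sigma>"
  have "initial_state_opaque \<Sigma> \<longleftrightarrow>
      (\<forall>\<alpha>\<in>lists (inputs \<Sigma>). \<forall>ys. \<not> ?revealing (start_states \<Sigma> \<alpha> ys))"
    unfolding initial_state_opaque_iff_start_states[OF assms] by blast
  also have "\<dots> \<longleftrightarrow> (\<forall>q\<in>snd ` ver_states \<Sigma>. \<not> ?revealing q)"
    unfolding snd_ver_states[OF assms(1) False] by blast
  also have "\<dots> \<longleftrightarrow> (\<forall>(q1, q2)\<in>ver_states \<Sigma>.
      q2 \<inter> init \<Sigma> \<noteq> {} \<longrightarrow> \<not> (q2 \<inter> init \<Sigma> \<subseteq> secret \<Sigma>))"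
    by (auto simp: split_beta)
  finally show ?thesis .
qed

end
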